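(* Let $M$ be a monoid and $S\subseteq M$ a generating subset with $1\in S$. Then $M$ admits a quadratic normalisation $(S,N)$ mod $1$ of class $(4,3)$ if, and only if, $(M,S)$ admits a factorability structure $\eta$ having any of the following (for a given $\eta$, equivalent) properties, where $f'=\eta'(f)$, $\overline{f}=\overline{\eta}(f)$, $F=\eta\circ\mu:M^2\to M^2$: (1) for all $s\in S_+$ and $f\in M$, $(sf)'=(sf')'$ and $\overline{sf}=\overline{sf'}\cdot\overline{f}$; (2) for all $(f,g,h)\in M^3$, $F_1F_2F_1F_2(f,g,h)=F_2F_1F_2(f,g,h)$; (3) for each $(r,s,t)\in S_+^3$ such that $F_2F_1F_2(r,s,t)$ contains $1$, $F_1F_2F_1F_2(r,s,t)=F_2F_1F_2(r,s,t)$.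
   Context: Notation. $\mu:M^2\to M$ is the multiplication, $S_+=S\setminus\{1\}$. $S^*$ is the free monoid over $S$; words are written $(s_1,\ldots,s_n)=s_1|\cdots|s_n$. For $f\in M$, $|f|$ is the minimal length of an $S$-word representing $f$ (so $|1|=0$). For a set $A$ and $F:A^2\to A^2$, $F_i$ applies $F$ to the entries at positions $i,i+1$ of a word over $A$ (counted from the left). Compositions are read with the rightmost map applied first. Factorability. A factorisation map for $(M,S)$ is a map $\eta=(\eta',\overline{\eta}):M\to M^2$ with $\eta(1)=(1,1)$ and, for every $f\ne1$: $\eta'(f)\in S_+$, $\eta'(f)\cdot\overline{\eta}(f)=f$, $|f|=|\eta'(f)|+|\overline{\eta}(f)|$. It is a factorability structure on $(M,S)$ if, with $F=\eta\circ\mu$, for every triple in $M^3$ either $F_1F_2F_1F_2$, $F_2F_1F_2$, $F_2F_1F_2F_1$ take the same value on it or each of these three maps strictly reduces the sum of the lengths of the entries. Normalisation. A normalisation is a pair $(A,N)$ with $N:A^*\to A^*$ length-preserving, identity on one-letter words, and $N(u|v|w)=N(u|N(v)|w)$ for all words $u,v,w$; $w$ is $N$-normal if $N(w)=w$; $\overline{N}$ is the restriction of $N$ to length-two words. $(A,N)$ is quadratic if a word is $N$-normal iff all its length-two factors are, and for each word $w$ there is a finite sequence of positions $(i_1,\ldots,i_k)$ with $N(w)=\overline{N}_{i_k}\cdots\overline{N}_{i_1}(w)$. $e\in A$ is $N$-neutral if $N(w|e)=N(e|w)=N(w)|e$ for all $w$. $(S,N)$ is a normalisation mod $1$ for $M$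 if $1\in S$ is $N$-neutral and $M$ is presented (via the inclusion $S\subseteq M$) by $\langle S\mid\{w=N(w):w\in S^*\}\cup\{1_S=1\}\rangle$, where $1_S$ is the letter $1$ of $S$. Class. A quadratic normalisation is of left-class $m$ (resp. right-class $n$) if for every length-three word $w$, $N(w)$ is obtained from $w$ by applying alternately $\overline{N}_1,\overline{N}_2,\ldots$ ($m$ maps in total, $\overline{N}_1$ first) (resp. $\overline{N}_2,\overline{N}_1,\ldots$, $n$ maps in total, $\overline{N}_2$ first). Class $(m,n)$ means left-class $m$ and right-class $n$. *)

theory Defs
  imports Main "HOL-Library.Sublist"
begin

text \<open>
  The monoid \<open>M\<close> is the type \<open>'a :: monoid_mult\<close>; words over a subset \<open>S\<close> of it are the elements
  of \<open>lists S\<close>, and \<^const>\<open>prod_list\<close> evaluates a word in \<open>M\<close>.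
  A map on words over \<open>S\<close> is a function on all lists of which only the values on \<open>lists S\<close> matter.
\<close>

definition generates :: "'a::monoid_mult set \<Rightarrow> bool" where
  "generates S \<longleftrightarrow> (\<forall>f. \<exists>w \<in> lists S. prod_list w = f)"

text \<open>Only meaningful if \<open>f\<close> is a product of elements of \<open>S\<close>; the empty word gives length 0 to 1.\<close>

definition mlen :: "'a::monoid_mult set \<Rightarrow> 'a \<Rightarrow> nat" where
  "mlen S f = (LEAST n. \<exists>w \<in> lists S. length w = n \<and> prod_list w = f)"

text \<open>
  Positions are counted from 1; \<open>apply_at F i\<close> is the map \<open>F\<^sub>i\<close>, for \<open>1 \<le> i < length w\<close>.
\<close>

definition apply_at :: "('a \<times> 'a \<Rightarrow> 'a \<times> 'a) \<Rightarrow> nat \<Rightarrow> 'a list \<Rightarrow> 'a list" where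
  "apply_at F i w =
     (case drop (i - 1) w of
        x # y # v \<Rightarrow> take (i - 1) w @ [fst (F (x, y)), snd (F (x, y))] @ v
      | _ \<Rightarrow> w)"


subsection \<open>Factorability\<close>

definition factorisation_map :: "'a::monoid_mult set \<Rightarrow> ('a \<Rightarrow> 'a \<times> 'a) \<Rightarrow> bool" where
  "factorisation_map S \<eta> \<longleftrightarrow>
     \<eta> 1 = (1, 1) \<and>
     (\<forall>f. f \<noteq> 1 \<longrightarrow>
        fst (\<eta> f) \<in> S - {1} \<and>
        fst (\<eta> f) * snd (\<eta> f) = f \<and>
        mlen S f = mlen S (fst (\<eta> f)) + mlen S (snd (\<eta> f)))"

definition eta_mult :: "('a::monoid_mult \<Rightarrow> 'a \<times> 'a) \<Rightarrow> 'a \<times> 'a \<Rightarrow> 'a \<times> 'a" where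
  "eta_mult \<eta> = (\<lambda>(f, g). \<eta> (f * g))"

definition F1212 :: "('a::monoid_mult \<Rightarrow> 'a \<times> 'a) \<Rightarrow> 'a list \<Rightarrow> 'a list" where
  "F1212 \<eta> = (let F = apply_at (eta_mult \<eta>) in F 1 \<circ> F 2 \<circ> F 1 \<circ> F 2)"

definition F212 :: "('a::monoid_mult \<Rightarrow> 'a \<times> 'a) \<Rightarrow> 'a list \<Rightarrow> 'a list" where
  "F212 \<eta> = (let F = apply_at (eta_mult \<eta>) in F 2 \<circ> F 1 \<circ> F 2)"

definition F2121 :: "('a::monoid_mult \<Rightarrow> 'a \<times> 'a) \<Rightarrow> 'a list \<Rightarrow> 'a list" where
  "F2121 \<eta> = (let F = apply_at (eta_mult \<eta>) in F 2 \<circ> F 1 \<circ> F 2 \<circ> F 1)"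

definition total_mlen :: "'a::monoid_mult set \<Rightarrow> 'a list \<Rightarrow> nat" where
  "total_mlen S w = sum_list (map (mlen S) w)"

definition factorability_structure :: "'a::monoid_mult set \<Rightarrow> ('a \<Rightarrow> 'a \<times> 'a) \<Rightarrow> bool" where
  "factorability_structure S \<eta> \<longleftrightarrow>
     factorisation_map S \<eta> \<and>
     (\<forall>f g h.
        (F1212 \<eta> [f, g, h] = F212 \<eta> [f, g, h] \<and> F212 \<eta> [f, g, h] = F2121 \<eta> [f, g, h]) \<or>
        (total_mlen S (F1212 \<eta> [f, g, h]) < total_mlen S [f, g, h] \<and>
         total_mlen S (F212 \<eta> [f, g, h]) < total_mlen S [f, g, h] \<and>
         total_mlen S (F2121 \<eta> [f, g, h]) < total_mlen S [f, g, h]))"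

definition left_recursive :: "'a::monoid_mult set \<Rightarrow> ('a \<Rightarrow> 'a \<times> 'a) \<Rightarrow> bool" where
  "left_recursive S \<eta> \<longleftrightarrow>
     (\<forall>s \<in> S - {1}. \<forall>f.
        fst (\<eta> (s * f)) = fst (\<eta> (s * fst (\<eta> f))) \<and>
        snd (\<eta> (s * f)) = snd (\<eta> (s * fst (\<eta> f))) * snd (\<eta> f))"

definition F_equal_everywhere :: "('a::monoid_mult \<Rightarrow> 'a \<times> 'a) \<Rightarrow> bool" where
  "F_equal_everywhere \<eta> \<longleftrightarrow> (\<forall>f g h. F1212 \<eta> [f, g, h] = F212 \<eta> [f, g, h])"

definition F_equal_if_one :: "'a::monoid_mult set \<Rightarrow> ('a \<Rightarrow> 'a \<times> 'a) \<Rightarrow> bool" where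
  "F_equal_if_one S \<eta> \<longleftrightarrow>
     (\<forall>r \<in> S - {1}. \<forall>s \<in> S - {1}. \<forall>t \<in> S - {1}.
        1 \<in> set (F212 \<eta> [r, s, t]) \<longrightarrow> F1212 \<eta> [r, s, t] = F212 \<eta> [r, s, t])"


subsection \<open>Normalisation\<close>

definition normalisation :: "'a set \<Rightarrow> ('a list \<Rightarrow> 'a list) \<Rightarrow> bool" where
  "normalisation A N \<longleftrightarrow>
     (\<forall>w \<in> lists A. N w \<in> lists A \<and> length (N w) = length w) \<and>
     (\<forall>a \<in> A. N [a] = [a]) \<and>
     (\<forall>u \<in> lists A. \<forall>v \<in> lists A. \<forall>w \<in> lists A. N (u @ v @ w) = N (u @ N v @ w))"

definition Nbar :: "('a list \<Rightarrow> 'a list) \<Rightarrow> 'a \<times> 'a \<Rightarrow> 'a \<times> 'a" where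
  "Nbar N = (\<lambda>(x, y). (N [x, y] ! 0, N [x, y] ! 1))"

definition quadratic_normalisation :: "'a set \<Rightarrow> ('a list \<Rightarrow> 'a list) \<Rightarrow> bool" where
  "quadratic_normalisation A N \<longleftrightarrow>
     normalisation A N \<and>
     (\<forall>w \<in> lists A. N w = w \<longleftrightarrow> (\<forall>x y. sublist [x, y] w \<longrightarrow> N [x, y] = [x, y])) \<and>
     (\<forall>w \<in> lists A. \<exists>is. set is \<subseteq> {1..<length w} \<and> N w = fold (apply_at (Nbar N)) is w)"

text \<open>The maps \<open>F\<^sub>i, F\<^sub>3\<^sub>-\<^sub>i, F\<^sub>i, \<dots>\<close> applied in this order, \<open>m\<close> of them in total.\<close>

primrec alternate :: "('a \<times> 'a \<Rightarrow> 'a \<times> 'a) \<Rightarrow> nat \<Rightarrow> nat \<Rightarrow> 'a list \<Rightarrow> 'a list" where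
  "alternate F i 0 w = w"
| "alternate F i (Suc m) w = alternate F (3 - i) m (apply_at F i w)"

definition left_class :: "'a set \<Rightarrow> ('a list \<Rightarrow> 'a list) \<Rightarrow> nat \<Rightarrow> bool" where
  "left_class A N m \<longleftrightarrow> (\<forall>w \<in> lists A. length w = 3 \<longrightarrow> N w = alternate (Nbar N) 1 m w)"

definition right_class :: "'a set \<Rightarrow> ('a list \<Rightarrow> 'a list) \<Rightarrow> nat \<Rightarrow> bool" where
  "right_class A N n \<longleftrightarrow> (\<forall>w \<in> lists A. length w = 3 \<longrightarrow> N w = alternate (Nbar N) 2 n w)"

definition of_class :: "'a set \<Rightarrow> ('a list \<Rightarrow> 'a list) \<Rightarrow> nat \<Rightarrow> nat \<Rightarrow> bool" where
  "of_class A N m n \<longleftrightarrow> left_class A N m \<and> right_class A N n"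

definition neutral :: "'a set \<Rightarrow> ('a list \<Rightarrow> 'a list) \<Rightarrow> 'a \<Rightarrow> bool" where
  "neutral A N e \<longleftrightarrow>
     e \<in> A \<and> (\<forall>w \<in> lists A. N (w @ [e]) = N w @ [e] \<and> N ([e] @ w) = N w @ [e])"

text \<open>The congruence on the free monoid \<open>lists A\<close> generated by the set \<open>R\<close> of relations.\<close>

inductive monoid_cong :: "'a set \<Rightarrow> ('a list \<times> 'a list) set \<Rightarrow> 'a list \<Rightarrow> 'a list \<Rightarrow> bool"
  for A R where
  rel: "(u, v) \<in> R \<Longrightarrow> u \<in> lists A \<Longrightarrow> v \<in> lists A \<Longrightarrow> monoid_cong A R u v"
| refl: "u \<in> lists A \<Longrightarrow> monoid_cong A R u u"
| sym: "monoid_cong A R u v \<Longrightarrow> monoid_cong A R v u"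
| trans: "monoid_cong A R u v \<Longrightarrow> monoid_cong A R v w \<Longrightarrow> monoid_cong A R u w"
| append: "monoid_cong A R u v \<Longrightarrow> monoid_cong A R u' v' \<Longrightarrow> monoid_cong A R (u @ u') (v @ v')"

text \<open>
  \<open>M\<close> is presented by \<open>\<langle>S | R\<rangle>\<close> via the inclusion of \<open>S\<close>: evaluation of words is well defined on
  congruence classes and induces a bijection from these onto \<open>M\<close>.
\<close>

definition presented_by :: "'a::monoid_mult set \<Rightarrow> ('a list \<times> 'a list) set \<Rightarrow> bool" where
  "presented_by S R \<longleftrightarrow>
     generates S \<and>
     (\<forall>u \<in> lists S. \<forall>v \<in> lists S. prod_list u = prod_list v \<longleftrightarrow> monoid_cong S R u v)"

definition normalisation_mod_one :: "'a::monoid_mult set \<Rightarrow> ('a list \<Rightarrow> 'a list) \<Rightarrow> bool" where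
  "normalisation_mod_one S N \<longleftrightarrow>
     normalisation S N \<and>
     neutral S N 1 \<and>
     presented_by S ({(w, N w) | w. w \<in> lists S} \<union> {([1], [])})"

end

theory Submission
  imports Defs
begin

text \<open>
  A quadratic normalisation \<open>N\<close> mod 1 splits \<open>f\<close> into the first letter of the normal form of \<open>f\<close> and
  the product of the other letters. Conversely, iterating \<open>\<eta>\<close> on the second component gives a normal
  form of \<open>f\<close>, which is padded with 1 to the length of the word to be normalised.
  Right-class 3 is the domino rule: to normalise \<open>s|w\<close> with \<open>w\<close> normal, one passes once through the
  word from left to right; this is property (1). If (1) holds, then \<open>F\<^sub>2F\<^sub>1F\<^sub>2\<close> sends a triple to the
  normal triple of its product, so everything is decided by whether \<open>F\<^sub>1\<close> fixes normal triples; this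
  follows from the definition of factorability applied to triples with first entry 1. The same trick
  shows that a word with normal length-two factors is normal.
\<close>

section \<open>Positions, length-two factors and alternating maps on words\<close>

lemma apply_at_simps [simp]:
  "apply_at F (Suc 0) (x # y # v) = fst (F (x, y)) # snd (F (x, y)) # v"
  "apply_at F 2 (z # x # y # v) = z # fst (F (x, y)) # snd (F (x, y)) # v"
  by (simp_all add: apply_at_def)

lemma apply_at_Suc_Cons:
  assumes "i \<ge> 1"
  shows "apply_at F (Suc i) (x # w) = x # apply_at F i w"
proof -
  obtain j where "i = Suc j" using assms by (cases i) auto
  then show ?thesis by (simp add: apply_at_def split: list.split)
qed

text \<open>Lets positions chosen for the tail of a word be reused behind one extra letter.\<close>

lemma fold_apply_at_Suc_Cons:
  assumes "\<forall>i \<in> set is. i \<ge> 1"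
  shows "fold (apply_at F) (map Suc is) (x # w) = x # fold (apply_at F) is w"
  using assms by (induction "is" arbitrary: w) (simp_all add: apply_at_Suc_Cons)

lemma all_sublist2_Cons_Cons:
  "(\<forall>x y. sublist [x, y] (a # b # w) \<longrightarrow> P x y) \<longleftrightarrow>
     P a b \<and> (\<forall>x y. sublist [x, y] (b # w) \<longrightarrow> P x y)"
  by (auto simp: sublist_Cons_right)

lemma not_sublist2_short [simp]: "\<not> sublist [x, y] []" "\<not> sublist [x, y] [a]"
  by (auto simp: sublist_Cons_right)

lemma alternate_3: "alternate F 2 3 w = apply_at F 2 (apply_at F 1 (apply_at F 2 w))"
  by (simp add: eval_nat_numeral)

lemma alternate_4: "alternate F 1 4 w = alternate F 2 3 (apply_at F 1 w)"
  by (simp add: eval_nat_numeral)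

lemma length_3E:
  assumes "length w = 3"
  obtains x y z where "w = [x, y, z]"
  using assms by (auto simp: eval_nat_numeral length_Suc_conv)


section \<open>Word length\<close>

locale generated_monoid =
  fixes S :: "'a::monoid_mult set"
  assumes one_in_S: "1 \<in> S" and gen: "generates S"
begin

lemma minimal_word: "\<exists>w \<in> lists S. length w = mlen S f \<and> prod_list w = f"
proof -
  obtain w where "w \<in> lists S" "prod_list w = f"
    using gen by (auto simp: generates_def)
  then show ?thesis
    unfolding mlen_def by (intro LeastI_ex[where P = "\<lambda>n. \<exists>w\<in>lists S. length w = n \<and> prod_list w = f"]) blast
qed

lemma mlen_prod_list_le: "w \<in> lists S \<Longrightarrow> mlen S (prod_list w) \<le> length w"
  unfolding mlen_def by (rule Least_le) blast

lemma mlen_1 [simp]: "mlen S 1 = 0"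
  using mlen_prod_list_le[of "[]"] by simp

lemma mlen_eq_0_iff [simp]: "mlen S f = 0 \<longleftrightarrow> f = 1"
  using minimal_word[of f] by auto

lemma mlen_mult_le: "mlen S (f * g) \<le> mlen S f + mlen S g"
proof -
  obtain u v where "u \<in> lists S" "length u = mlen S f" "prod_list u = f"
    "v \<in> lists S" "length v = mlen S g" "prod_list v = g"
    using minimal_word by metis
  then show ?thesis using mlen_prod_list_le[of "u @ v"] by simp
qed

text \<open>Since 1 is a letter, \<open>S\<close> is the whole ball of radius 1, so membership in
  \<open>S\<close> becomes a length bound.\<close>

lemma mlen_le_1_iff: "mlen S f \<le> 1 \<longleftrightarrow> f \<in> S"
proof
  assume "mlen S f \<le> 1"
  moreover obtain w where "w \<in> lists S" "length w = mlen S f" "prod_list w = f"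
    using minimal_word by blast
  ultimately show "f \<in> S"
    using one_in_S by (cases w; cases "tl w") auto
next
  assume "f \<in> S"
  then show "mlen S f \<le> 1" using mlen_prod_list_le[of "[f]"] by simp
qed

lemma mlen_generator: "s \<in> S \<Longrightarrow> s \<noteq> 1 \<Longrightarrow> mlen S s = 1"
  using mlen_le_1_iff[of s] mlen_eq_0_iff[of s] by linarith

end


section \<open>Factorisation maps\<close>

locale factorised_monoid = generated_monoid S for S :: "'a::monoid_mult set" +
  fixes \<eta> :: "'a \<Rightarrow> 'a \<times> 'a"
  assumes fmap: "factorisation_map S \<eta>"
begin

abbreviation lhead :: "'a \<Rightarrow> 'a" where "lhead f \<equiv> fst (\<eta> f)"
abbreviation ltail :: "'a \<Rightarrow> 'a" where "ltail f \<equiv> snd (\<eta> f)"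

lemma eta_1 [simp]: "\<eta> 1 = (1, 1)"
  using fmap by (simp add: factorisation_map_def)

lemma lhead_in_S [simp]: "lhead f \<in> S"
  using fmap one_in_S by (cases "f = 1") (auto simp: factorisation_map_def)

lemma lhead_eq_1_iff [simp]: "lhead f = 1 \<longleftrightarrow> f = 1"
  using fmap by (cases "f = 1") (auto simp: factorisation_map_def)

lemma lhead_ltail [simp]: "lhead f * ltail f = f"
  using fmap by (cases "f = 1") (auto simp: factorisation_map_def)

lemma mlen_eta: "mlen S f = mlen S (lhead f) + mlen S (ltail f)"
proof (cases "f = 1")
  case False
  then show ?thesis using fmap unfolding factorisation_map_def by blast
qed simp

lemma mlen_ltail: "f \<noteq> 1 \<Longrightarrow> mlen S f = Suc (mlen S (ltail f))"
  using mlen_eta[of f] mlen_generator[of "lhead f"] by simp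

lemma mlen_ltail_le: "mlen S f \<le> Suc k \<Longrightarrow> mlen S (ltail f) \<le> k"
  using mlen_ltail[of f] by (cases "f = 1") auto

lemma eta_generator: "s \<in> S \<Longrightarrow> \<eta> s = (s, 1)"
proof (cases "s = 1")
  case False
  assume "s \<in> S"
  then have "ltail s = 1"
    using mlen_ltail[OF False] mlen_generator[OF _ False] by simp
  then show ?thesis using lhead_ltail[of s] by (simp add: prod_eq_iff)
qed simp

text \<open>Makes \<open>\<eta>\<close> after multiplication a map from pairs of letters to pairs of
  letters, as \<open>Nbar\<close> has to be.\<close>

lemma ltail_mult_in_S: "s \<in> S \<Longrightarrow> t \<in> S \<Longrightarrow> ltail (s * t) \<in> S"
  using mlen_mult_le[of s t] mlen_ltail_le[of "s * t" 1] mlen_le_1_iff[of s] mlen_le_1_iff[of t]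
    mlen_le_1_iff[of "ltail (s * t)"] by linarith

section \<open>Explicit values of the composite maps on triples\<close>

lemma F212_eq:
  "F212 \<eta> [f, g, h] =
     [lhead (f * lhead (g * h)),
      lhead (ltail (f * lhead (g * h)) * ltail (g * h)),
      ltail (ltail (f * lhead (g * h)) * ltail (g * h))]"
  by (simp add: F212_def eta_mult_def Let_def)

lemma F1212_eq: "F1212 \<eta> [f, g, h] = apply_at (eta_mult \<eta>) 1 (F212 \<eta> [f, g, h])"
  by (simp add: F1212_def F212_def Let_def)

lemma F2121_eq: "F2121 \<eta> [f, g, h] = F212 \<eta> [lhead (f * g), ltail (f * g), h]"
  by (simp add: F2121_def F212_def eta_mult_def Let_def)

definition normal_triple :: "'a \<Rightarrow> 'a list" where
  "normal_triple f = [lhead f, lhead (ltail f), ltail (ltail f)]"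

lemma total_mlen_normal_triple: "total_mlen S (normal_triple f) = mlen S f"
  using mlen_eta[of f] mlen_eta[of "ltail f"]
  by (simp add: total_mlen_def normal_triple_def)

text \<open>Property (1) passes from letters to arbitrary left factors by writing the factor as a
  word and peeling off its letters.\<close>

lemma left_recursive_eta:
  assumes "left_recursive S \<eta>"
  shows "\<eta> (f * g) = (lhead (f * lhead g), ltail (f * lhead g) * ltail g)"
proof -
  \<comment> \<open>Property (1) excludes the letter 1; there the identity holds because the letter
    \<open>lhead g\<close> has tail 1.\<close>
  have gen_case: "lhead (s * g) = lhead (s * lhead g) \<and> ltail (s * g) = ltail (s * lhead g) * ltail g"
    if "s \<in> S" for s g
  proof (cases "s = 1")
    case False
    then show ?thesis using that assms unfolding left_recursive_def by blast
  qed (simp add: eta_generator)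
  obtain w where w: "w \<in> lists S" "prod_list w = f"
    using gen by (auto simp: generates_def)
  have "lhead (prod_list w * g) = lhead (prod_list w * lhead g) \<and>
    ltail (prod_list w * g) = ltail (prod_list w * lhead g) * ltail g"
    using w(1)
  proof (induction w)
    case Nil
    then show ?case by (simp add: eta_generator)
  next
    case (Cons s w)
    then have s: "s \<in> S" and IH: "lhead (prod_list w * g) = lhead (prod_list w * lhead g)"
      "ltail (prod_list w * g) = ltail (prod_list w * lhead g) * ltail g"
      by simp_all
    show ?case
      using gen_case[OF s, of "prod_list w * g"] gen_case[OF s, of "prod_list w * lhead g"]
      by (simp add: IH mult.assoc)
  qed
  then show ?thesis using w(2) by (simp add: prod_eq_iff)
qed

text \<open>By the recursion with right factor \<open>g * h\<close>, the first two maps already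
  produce the head of the product and a factorisation of its tail; the last map splits that
  tail.\<close>

lemma left_recursive_F212:
  assumes "left_recursive S \<eta>"
  shows "F212 \<eta> [f, g, h] = normal_triple (f * g * h)"
  using left_recursive_eta[OF assms, of f "g * h"]
  by (simp add: F212_eq normal_triple_def mult.assoc)

lemma left_recursive_F2121:
  assumes "left_recursive S \<eta>"
  shows "F2121 \<eta> [f, g, h] = normal_triple (f * g * h)"
  by (simp add: F2121_eq left_recursive_F212[OF assms])

end


section \<open>Factorability structures\<close>

locale factorable_monoid = factorised_monoid +
  assumes factorable: "factorability_structure S \<eta>"
begin

lemma factorable_cases:
  "(F1212 \<eta> [f, g, h] = F212 \<eta> [f, g, h] \<and> F212 \<eta> [f, g, h] = F2121 \<eta> [f, g, h]) \<or>
   (total_mlen S (F1212 \<eta> [f, g, h]) < total_mlen S [f, g, h] \<and>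
    total_mlen S (F212 \<eta> [f, g, h]) < total_mlen S [f, g, h] \<and>
    total_mlen S (F2121 \<eta> [f, g, h]) < total_mlen S [f, g, h])"
  using factorable unfolding factorability_structure_def by blast

text \<open>On \<open>[1, lhead f, ltail f]\<close> the map \<open>F212\<close> gives the normal
  triple without loss of length. This rules out the reducing alternative, and equality with
  \<open>F1212\<close> says that the map at position 1 fixes the normal triple.\<close>

lemma eta_head_pair: "\<eta> (lhead f * lhead (ltail f)) = (lhead f, lhead (ltail f))"
proof -
  have F: "F212 \<eta> [1, lhead f, ltail f] = normal_triple f"
    by (simp add: F212_eq normal_triple_def eta_generator)
  have "total_mlen S [1, lhead f, ltail f] = mlen S f"
    using mlen_eta[of f] by (simp add: total_mlen_def)
  then have "F1212 \<eta> [1, lhead f, ltail f] = normal_triple f"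
    using factorable_cases[of 1 "lhead f" "ltail f"] F by (simp add: total_mlen_normal_triple)
  then show ?thesis
    unfolding F1212_eq F by (simp add: normal_triple_def eta_mult_def prod_eq_iff)
qed

text \<open>Recognition principle: whether \<open>(s, g)\<close> is a value of \<open>\<eta>\<close> is decided by \<open>s\<close> and the head of \<open>g\<close>.\<close>

lemma eta_recognition:
  assumes s: "s \<in> S" and st: "\<eta> (s * lhead g) = (s, lhead g)"
  shows "\<eta> (s * g) = (s, g)"
proof -
  \<comment> \<open>On \<open>[1, s, g]\<close> the path starting at position 1 merely splits
    \<open>g\<close>. No length is lost, so the other path must end in the same triple.\<close>
  have F': "F2121 \<eta> [1, s, g] = [s, lhead g, ltail g]"
    using s st by (simp add: F2121_eq F212_eq eta_generator)
  moreover have "total_mlen S [1, s, g] = total_mlen S [s, lhead g, ltail g]"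
    using mlen_eta[of g] by (simp add: total_mlen_def)
  ultimately have "F212 \<eta> [1, s, g] = [s, lhead g, ltail g]"
    using factorable_cases[of 1 s g] by auto
  then have "lhead (s * g) = s" "\<eta> (ltail (s * g)) = \<eta> g"
    by (simp_all add: F212_eq eta_generator prod_eq_iff)
  \<comment> \<open>Multiplication undoes \<open>\<eta>\<close>, so equal values force the tail of
    \<open>s * g\<close> to be \<open>g\<close>.\<close>
  then show ?thesis
    using lhead_ltail[of "ltail (s * g)"] lhead_ltail[of g] by (metis prod_eq_iff fst_conv snd_conv)
qed

section \<open>Equivalence of the three properties\<close>

lemma left_recursive_imp_F_equal:
  assumes "left_recursive S \<eta>"
  shows "F_equal_everywhere \<eta>"
  unfolding F_equal_everywhere_def F1212_eq left_recursive_F212[OF assms]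
  by (simp add: normal_triple_def eta_mult_def eta_head_pair)

text \<open>If 1 occurs neither in the triple nor in its image, both consist of three letters of
  length 1, so factorability forces equality. If the triple contains 1, it behaves like a pair and
  both sides can be computed.\<close>

lemma F_equal_if_one_imp_F_equal_generators:
  assumes eq: "F_equal_if_one S \<eta>" and S: "r \<in> S" "s \<in> S" "t \<in> S"
  shows "F1212 \<eta> [r, s, t] = F212 \<eta> [r, s, t]"
proof -
  consider "r = 1" | "s = 1" | "t = 1" | "r \<noteq> 1" "s \<noteq> 1" "t \<noteq> 1" by blast
  then show ?thesis
  proof cases
    case 4
    show ?thesis
    proof (cases "1 \<in> set (F212 \<eta> [r, s, t])")
      case True
      then show ?thesis using eq 4 S by (auto simp: F_equal_if_one_def)
    next
      case False
      have in_S: "set (F212 \<eta> [r, s, t]) \<subseteq> S"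
        using S by (simp add: F212_eq ltail_mult_in_S)
      obtain a b c where abc: "F212 \<eta> [r, s, t] = [a, b, c]"
        by (simp add: F212_eq)
      have "mlen S a = 1" "mlen S b = 1" "mlen S c = 1"
        using False in_S mlen_generator unfolding abc by auto
      moreover have "mlen S r = 1" "mlen S s = 1" "mlen S t = 1"
        using 4 S mlen_generator by auto
      ultimately show ?thesis
        using factorable_cases[of r s t] abc by (simp add: total_mlen_def)
    qed
  qed (use S in \<open>simp_all add: F1212_eq F212_eq eta_mult_def eta_generator case_prod_beta ltail_mult_in_S\<close>)
qed

lemma F_equal_if_one_imp_left_recursive:
  assumes eq: "F_equal_if_one S \<eta>"
  shows "left_recursive S \<eta>"
proof -
  have "\<eta> (s * f) = (lhead (s * lhead f), ltail (s * lhead f) * ltail f)" if "s \<in> S" for s f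
    using that
  proof (induction "mlen S f" arbitrary: s f rule: less_induct)
    case less
    show ?case
    proof (cases "f = 1")
      case True
      then show ?thesis using less.prems by (simp add: eta_generator)
    next
      case False
      define a b where "a = lhead (s * lhead f)" and "b = ltail (s * lhead f)"
      have S: "a \<in> S" "b \<in> S"
        using less.prems by (simp_all add: a_def b_def ltail_mult_in_S)
      have "mlen S (ltail f) < mlen S f"
        using mlen_ltail[OF False] by simp
      from less.hyps[OF this S(2)] have "lhead (b * ltail f) = lhead (b * lhead (ltail f))"
        by simp
      \<comment> \<open>Equality on the triple \<open>s\<close>, \<open>lhead f\<close>,
        \<open>lhead (ltail f)\<close>: its last two letters are fixed by
        \<open>eta_head_pair\<close>, and this equation says that the final map at position 1
        changes nothing.\<close>
      moreover have "\<eta> (a * lhead (b * lhead (ltail f))) = (a, lhead (b * lhead (ltail f)))"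
        using F_equal_if_one_imp_F_equal_generators[OF eq less.prems lhead_in_S[of f] lhead_in_S[of "ltail f"]]
        unfolding F1212_eq
        by (simp add: F212_eq eta_head_pair eta_mult_def prod_eq_iff a_def b_def)
      ultimately have "\<eta> (a * (b * ltail f)) = (a, b * ltail f)"
        using S by (simp add: eta_recognition)
      moreover have "a * (b * ltail f) = s * f"
        by (metis a_def b_def lhead_ltail mult.assoc)
      ultimately show ?thesis by (simp add: a_def b_def)
    qed
  qed
  then show ?thesis unfolding left_recursive_def by (metis DiffD1 fst_conv snd_conv)
qed

lemma properties_equivalent:
  shows "left_recursive S \<eta> \<longleftrightarrow> F_equal_everywhere \<eta>"
    and "F_equal_everywhere \<eta> \<longleftrightarrow> F_equal_if_one S \<eta>"
proof -
  have "F_equal_everywhere \<eta> \<Longrightarrow> F_equal_if_one S \<eta>"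
    by (simp add: F_equal_everywhere_def F_equal_if_one_def)
  then show "left_recursive S \<eta> \<longleftrightarrow> F_equal_everywhere \<eta>"
    and "F_equal_everywhere \<eta> \<longleftrightarrow> F_equal_if_one S \<eta>"
    using left_recursive_imp_F_equal F_equal_if_one_imp_left_recursive by blast+
qed

end


section \<open>From factorability to normalisation\<close>

context factorable_monoid
begin

text \<open>The normal word of \<open>f\<close>, padded with 1 on the right, or cut off, to length \<open>k\<close>.\<close>

primrec normal_word :: "nat \<Rightarrow> 'a \<Rightarrow> 'a list" where
  "normal_word 0 f = []"
| "normal_word (Suc k) f = lhead f # normal_word k (ltail f)"

text \<open>Only the length and the product of the word matter, which makes the axioms of a
  normalisation immediate.\<close>

definition normal_map :: "'a list \<Rightarrow> 'a list" where
  "normal_map w = normal_word (length w) (prod_list w)"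

lemma normal_word_in_S: "normal_word k f \<in> lists S"
  by (induction k arbitrary: f) simp_all

lemma length_normal_word [simp]: "length (normal_word k f) = k"
  by (induction k arbitrary: f) simp_all

lemma prod_list_normal_word: "mlen S f \<le> k \<Longrightarrow> prod_list (normal_word k f) = f"
  by (induction k arbitrary: f) (simp_all add: mlen_ltail_le)

lemma prod_list_normal_map: "w \<in> lists S \<Longrightarrow> prod_list (normal_map w) = prod_list w"
  unfolding normal_map_def by (rule prod_list_normal_word[OF mlen_prod_list_le])

lemma normal_word_pad: "mlen S f \<le> k \<Longrightarrow> normal_word (k + j) f = normal_word k f @ replicate j 1"
proof (induction k arbitrary: f)
  case 0
  have "normal_word j 1 = replicate j 1" by (induction j) simp_all
  with 0 show ?case by simp
qed (simp add: mlen_ltail_le)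

lemma normal_map_pair:
  assumes "x \<in> S" "y \<in> S"
  shows "normal_map [x, y] = [lhead (x * y), ltail (x * y)]"
  using assms by (simp add: normal_map_def ltail_mult_in_S eta_generator)

lemma Nbar_normal_map:
  assumes "x \<in> S" "y \<in> S"
  shows "Nbar normal_map (x, y) = \<eta> (x * y)"
  by (simp add: Nbar_def normal_map_pair[OF assms])

lemma normalisation_normal_map: "normalisation S normal_map"
  unfolding normalisation_def
proof (intro conjI ballI)
  fix u v w assume "u \<in> lists S" "v \<in> lists S" "w \<in> lists S"
  then show "normal_map (u @ v @ w) = normal_map (u @ normal_map v @ w)"
    using prod_list_normal_map[of v] by (simp add: normal_map_def)
qed (simp_all add: normal_map_def normal_word_in_S eta_generator del: in_lists_conv_set)

text \<open>One direction is \<open>eta_head_pair\<close>, the other is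
  \<open>eta_recognition\<close>, each applied at the first two letters.\<close>

lemma normal_map_fixed_iff:
  assumes "w \<in> lists S"
  shows "normal_map w = w \<longleftrightarrow> (\<forall>x y. sublist [x, y] w \<longrightarrow> normal_map [x, y] = [x, y])"
  using assms
proof (induction w rule: induct_list012)
  case 1
  then show ?case by (simp add: normal_map_def)
next
  case (2 x)
  then show ?case by (simp add: normal_map_def eta_generator)
next
  case (3 x y w)
  then have S: "x \<in> S" "y \<in> S" "y # w \<in> lists S" by simp_all
  define g where "g = prod_list (y # w)"
  have step: "normal_map (x # y # w) = x # y # w \<longleftrightarrow>
      normal_map [x, y] = [x, y] \<and> normal_map (y # w) = y # w"
  proof
    assume fixed: "normal_map (x # y # w) = x # y # w"
    let ?f = "x * g"
    have *: "lhead ?f = x" "normal_word (Suc (length w)) (ltail ?f) = y # w"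
      using fixed by (simp_all add: normal_map_def g_def)
    then have "lhead (ltail ?f) = y" by simp
    with * have "\<eta> (x * y) = (x, y)" using eta_head_pair[of ?f] by simp
    then have "normal_map [x, y] = [x, y]" using S by (simp add: normal_map_pair)
    \<comment> \<open>The bound ensures that the normal word is not cut off, so that its product
      recovers the tail.\<close>
    moreover have "mlen S ?f \<le> Suc (Suc (length w))"
      using mlen_prod_list_le[OF 3(3)] by (simp add: g_def)
    then have "prod_list (y # w) = ltail ?f"
      using prod_list_normal_word[of "ltail ?f" "Suc (length w)"] mlen_ltail_le *(2) by simp
    then have "normal_map (y # w) = y # w"
      using *(2) by (simp add: normal_map_def)
    ultimately show "normal_map [x, y] = [x, y] \<and> normal_map (y # w) = y # w" ..
  next
    assume fixed: "normal_map [x, y] = [x, y] \<and> normal_map (y # w) = y # w"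
    then have "\<eta> (x * y) = (x, y)" using S by (simp add: normal_map_pair prod_eq_iff)
    moreover have "lhead g = y" using fixed by (simp add: normal_map_def g_def)
    ultimately have "\<eta> (x * g) = (x, g)" using S by (simp add: eta_recognition)
    then show "normal_map (x # y # w) = x # y # w"
      using fixed by (simp add: normal_map_def g_def)
  qed
  show ?case unfolding step all_sublist2_Cons_Cons using 3(2) S by simp
qed

text \<open>The domino pass: position 1 settles the first letter, and the remaining positions act in
  the same way on \<open>ltail (s * lhead g)\<close> followed by the normal word of
  \<open>ltail g\<close>.\<close>

lemma fold_apply_at_normal_word:
  assumes "left_recursive S \<eta>" "s \<in> S" "mlen S g \<le> k"
  shows "fold (apply_at (Nbar normal_map)) [1..<Suc k] (s # normal_word k g) = normal_word (Suc k) (s * g)"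
  using assms(2,3)
proof (induction k arbitrary: s g)
  case 0
  then show ?case by (simp add: eta_generator)
next
  case (Suc k)
  define b where "b = ltail (s * lhead g)"
  have b: "b \<in> S" using Suc.prems by (simp add: b_def ltail_mult_in_S)
  have rec: "\<eta> (s * g) = (lhead (s * lhead g), b * ltail g)"
    using left_recursive_eta[OF assms(1), of s g] by (simp add: b_def)
  have "fold (apply_at (Nbar normal_map)) [1..<Suc (Suc k)] (s # normal_word (Suc k) g) =
     fold (apply_at (Nbar normal_map)) (map Suc [1..<Suc k]) (lhead (s * lhead g) # b # normal_word k (ltail g))"
    using Suc.prems by (simp add: upt_conv_Cons map_Suc_upt Nbar_normal_map b_def del: upt_Suc)
  also have "\<dots> = lhead (s * lhead g) # normal_word (Suc k) (b * ltail g)"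
    using Suc.IH[OF b mlen_ltail_le[OF Suc.prems(2)]]
    by (subst fold_apply_at_Suc_Cons) (auto simp del: upt_Suc)
  finally show ?case by (simp add: rec)
qed

lemma normal_map_by_positions:
  assumes "left_recursive S \<eta>" "w \<in> lists S"
  shows "\<exists>is. set is \<subseteq> {1..<length w} \<and> normal_map w = fold (apply_at (Nbar normal_map)) is w"
  using assms(2)
proof (induction w)
  case Nil
  then show ?case by (intro exI[of _ "[]"]) (simp add: normal_map_def)
next
  case (Cons s w)
  then obtain "is" where "is": "set is \<subseteq> {1..<length w}"
    "normal_map w = fold (apply_at (Nbar normal_map)) is w" and S: "s \<in> S" "w \<in> lists S"
    by auto
  \<comment> \<open>The tail is normalised first, at shifted positions; one pass from left to right
    then brings in \<open>s\<close>.\<close>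
  let ?is = "map Suc is @ [1..<Suc (length w)]"
  have "fold (apply_at (Nbar normal_map)) (map Suc is) (s # w) = s # normal_map w"
    using "is" by (subst fold_apply_at_Suc_Cons) auto
  then have "fold (apply_at (Nbar normal_map)) ?is (s # w) = normal_map (s # w)"
    using fold_apply_at_normal_word[OF assms(1) S(1) mlen_prod_list_le[OF S(2)]]
    by (simp add: normal_map_def del: upt_Suc)
  moreover have "set ?is \<subseteq> {1..<length (s # w)}" using "is"(1) by auto
  ultimately show ?case by metis
qed

lemma quadratic_normal_map:
  assumes "left_recursive S \<eta>"
  shows "quadratic_normalisation S normal_map"
  using normalisation_normal_map normal_map_fixed_iff normal_map_by_positions[OF assms]
  unfolding quadratic_normalisation_def by blast

lemma of_class_normal_map:
  assumes "left_recursive S \<eta>"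
  shows "of_class S normal_map 4 3"
proof -
  have right: "normal_map [x, y, z] = alternate (Nbar normal_map) 2 3 [x, y, z]"
    if S: "x \<in> S" "y \<in> S" "z \<in> S" for x y z
  proof -
    \<comment> \<open>Hence the third entry of the normal triple is a letter and equals its own
      head.\<close>
    have "mlen S (x * y * z) \<le> 3"
      using mlen_prod_list_le[of "[x, y, z]"] S by (simp add: mult.assoc)
    then have "ltail (ltail (x * y * z)) \<in> S"
      using mlen_ltail_le[of "x * y * z" 2] mlen_ltail_le[of "ltail (x * y * z)" 1]
      by (simp flip: mlen_le_1_iff)
    then have "normal_map [x, y, z] = normal_triple (x * y * z)"
      by (simp add: normal_map_def normal_triple_def eta_generator mult.assoc)
    also have "\<dots> = F212 \<eta> [x, y, z]"
      by (rule left_recursive_F212[OF assms, symmetric])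
    also have "\<dots> = alternate (Nbar normal_map) 2 3 [x, y, z]"
      using S unfolding alternate_3 by (simp add: F212_eq Nbar_normal_map ltail_mult_in_S)
    finally show ?thesis .
  qed
  \<comment> \<open>The first map keeps length and product, hence the normal form; right-class 3
    does the rest.\<close>
  have "normal_map [x, y, z] = alternate (Nbar normal_map) 1 4 [x, y, z]"
    if S: "x \<in> S" "y \<in> S" "z \<in> S" for x y z
    unfolding alternate_4
    using right[of "lhead (x * y)" "ltail (x * y)" z] S
    by (simp add: Nbar_normal_map ltail_mult_in_S normal_map_def flip: mult.assoc)
  with right show ?thesis
    unfolding of_class_def left_class_def right_class_def by (auto elim!: length_3E)
qed

lemma normalisation_mod_one_normal_map: "normalisation_mod_one S normal_map"
proof -
  have pad: "normal_map (w @ replicate j 1) = normal_map w @ replicate j 1" if "w \<in> lists S" for w j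
    using normal_word_pad[OF mlen_prod_list_le[OF that]] by (simp add: normal_map_def)
  have swap: "normal_map (1 # w) = normal_map (w @ [1])" for w
    by (simp add: normal_map_def)
  have neutral: "neutral S normal_map 1"
    using pad[of _ 1] one_in_S by (simp add: neutral_def swap)
  let ?R = "{(w, normal_map w) | w. w \<in> lists S} \<union> {([1], [])}"
  have sound: "prod_list u = prod_list v" if "monoid_cong S ?R u v" for u v
    using that by (induction rule: monoid_cong.induct) (auto simp: prod_list_normal_map[OF in_listsI])
  have cong_pad: "monoid_cong S ?R u (u @ replicate j 1)" if "u \<in> lists S" for u j
  proof (induction j)
    case 0
    then show ?case using that by (simp add: monoid_cong.refl)
  next
    case (Suc j)
    have "monoid_cong S ?R [] [1]"
      using one_in_S by (intro monoid_cong.sym[OF monoid_cong.rel]) auto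
    from monoid_cong.append[OF Suc this] show ?case
      by (simp add: replicate_append_same)
  qed
  have cong_normal: "monoid_cong S ?R u (normal_word (length u + j) (prod_list u))" if "u \<in> lists S" for u j
  proof -
    have S: "u @ replicate j 1 \<in> lists S" using that one_in_S by auto
    have "monoid_cong S ?R (u @ replicate j 1) (normal_map (u @ replicate j 1))"
      using S normal_word_in_S by (intro monoid_cong.rel) (auto simp: normal_map_def)
    then show ?thesis
      using monoid_cong.trans[OF cong_pad[OF that]] by (simp add: normal_map_def)
  qed
  \<comment> \<open>Both words are congruent to the normal word of their common product, padded to
    the sum of their lengths.\<close>
  have "monoid_cong S ?R u v" if "u \<in> lists S" "v \<in> lists S" "prod_list u = prod_list v" for u v
  proof (rule monoid_cong.trans[OF cong_normal[OF that(1), of "length v"] monoid_cong.sym])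
    show "monoid_cong S ?R v (normal_word (length u + length v) (prod_list u))"
      using cong_normal[OF that(2), of "length u"] that(3) by (simp only: add.commute)
  qed
  with sound have "presented_by S ?R"
    unfolding presented_by_def using gen by blast
  with neutral normalisation_normal_map show ?thesis
    unfolding normalisation_mod_one_def by blast
qed

end


section \<open>From normalisation to factorability\<close>

locale normalised_monoid = generated_monoid S for S :: "'a::monoid_mult set" +
  fixes N :: "'a list \<Rightarrow> 'a list"
  assumes quadratic: "quadratic_normalisation S N"
    and mod_one: "normalisation_mod_one S N"
    and right3: "right_class S N 3"
begin

lemma norm: "normalisation S N"
  using quadratic by (simp add: quadratic_normalisation_def)

lemma N_in_S [simp]: "w \<in> lists S \<Longrightarrow> N w \<in> lists S"
  and length_N [simp]: "w \<in> lists S \<Longrightarrow> length (N w) = length w"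
  and N_single [simp]: "a \<in> S \<Longrightarrow> N [a] = [a]"
  using norm unfolding normalisation_def by blast+

lemma N_Nil [simp]: "N [] = []"
  using length_N[OF lists.Nil] by (simp del: length_N)

lemma N_factor:
  "u \<in> lists S \<Longrightarrow> v \<in> lists S \<Longrightarrow> w \<in> lists S \<Longrightarrow> N (u @ N v @ w) = N (u @ v @ w)"
  using norm unfolding normalisation_def by metis

lemma N_idem: "w \<in> lists S \<Longrightarrow> N (N w) = N w"
  using N_factor[of "[]" w "[]"] by simp

lemma N_fixed_iff:
  "w \<in> lists S \<Longrightarrow> N w = w \<longleftrightarrow> (\<forall>x y. sublist [x, y] w \<longrightarrow> N [x, y] = [x, y])"
  using quadratic unfolding quadratic_normalisation_def by blast

lemma N_fixed_Cons_Cons_iff: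
  assumes "x # y # w \<in> lists S"
  shows "N (x # y # w) = x # y # w \<longleftrightarrow> N [x, y] = [x, y] \<and> N (y # w) = y # w"
  using N_fixed_iff[OF assms] N_fixed_iff[of "y # w"] assms by (simp add: all_sublist2_Cons_Cons)

lemma N_pair:
  assumes "x \<in> S" "y \<in> S"
  obtains a b where "N [x, y] = [a, b]" "a \<in> S" "b \<in> S"
  using N_in_S[of "[x, y]"] length_N[of "[x, y]"] assms
  by (auto simp: length_Suc_conv simp del: N_in_S length_N)

section \<open>Moving the neutral letter to the right end\<close>

lemma N_append_ones: "w \<in> lists S \<Longrightarrow> N (w @ replicate j 1) = N w @ replicate j 1"
proof (induction j)
  case (Suc j)
  have "w @ replicate j 1 \<in> lists S" using Suc.prems one_in_S by auto
  then have "N ((w @ replicate j 1) @ [1]) = N (w @ replicate j 1) @ [1]"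
    using mod_one unfolding normalisation_mod_one_def neutral_def by blast
  with Suc show ?case by (simp add: replicate_append_same)
qed simp

lemma N_one_Cons: "w \<in> lists S \<Longrightarrow> N (1 # w) = N w @ [1]"
  using mod_one by (simp add: normalisation_mod_one_def neutral_def)

lemma N_ones_append: "w \<in> lists S \<Longrightarrow> N (replicate j 1 @ w) = N w @ replicate j 1"
proof (induction j)
  case (Suc j)
  then have "replicate j 1 @ w \<in> lists S" using one_in_S by auto
  from N_one_Cons[OF this] show ?case using Suc by (simp add: replicate_append_same)
qed simp

text \<open>Normalising the right block first carries the letters 1 to the end of the word.\<close>

lemma N_ones_middle:
  assumes "u \<in> lists S" "v \<in> lists S"
  shows "N (u @ replicate j 1 @ v) = N (u @ v) @ replicate j 1"
proof -
  have ones: "replicate j 1 \<in> lists S" using one_in_S by auto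
  have "N (u @ replicate j 1 @ v) = N (u @ N (replicate j 1 @ v))"
    using N_factor[of u "replicate j 1 @ v" "[]"] assms ones by simp
  also have "\<dots> = N ((u @ N v) @ replicate j 1)"
    using assms by (simp add: N_ones_append)
  also have "\<dots> = N (u @ N v) @ replicate j 1"
    using assms N_in_S[of v] by (intro N_append_ones) auto
  also have "N (u @ N v) = N (u @ v)"
    using N_factor[of u v "[]"] assms by simp
  finally show ?thesis .
qed

section \<open>Uniqueness of normal forms from the presentation\<close>

abbreviation relations :: "('a list \<times> 'a list) set" where
  "relations \<equiv> {(w, N w) | w. w \<in> lists S} \<union> {([1], [])}"

lemma prod_list_eq_iff_cong:
  "u \<in> lists S \<Longrightarrow> v \<in> lists S \<Longrightarrow> prod_list u = prod_list v \<longleftrightarrow> monoid_cong S relations u v"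
  using mod_one unfolding normalisation_mod_one_def presented_by_def by blast

lemma prod_list_N:
  assumes "w \<in> lists S"
  shows "prod_list (N w) = prod_list w"
proof -
  have "monoid_cong S relations w (N w)"
    using assms N_in_S by (intro monoid_cong.rel) blast+
  then show ?thesis using prod_list_eq_iff_cong[of w "N w"] assms by simp
qed

text \<open>The normal form up to trailing letters 1 is an invariant of the congruence.\<close>

lemma monoid_cong_imp_N_eq:
  "monoid_cong S relations u v \<Longrightarrow>
     u \<in> lists S \<and> v \<in> lists S \<and> (\<exists>i j. N u @ replicate i 1 = N v @ replicate j 1)"
proof (induction rule: monoid_cong.induct)
  case (rel u v)
  \<comment> \<open>The padding is empty for a pair \<open>(w, N w)\<close> and a single letter for
    \<open>([1], [])\<close>.\<close>
  have "N u @ replicate 0 1 = N v @ replicate (length u - length v) 1"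
    using rel one_in_S by (auto simp: N_idem[OF in_listsI] length_N[OF in_listsI])
  then show ?case using rel by blast
next
  case (sym u v)
  then show ?case by metis
next
  case (trans u v w)
  then obtain i j k l where "N u @ replicate i 1 = N v @ replicate j 1"
    "N v @ replicate k 1 = N w @ replicate l 1" by blast
  then have "N u @ replicate (i + k) 1 = N w @ replicate (l + j) 1"
    by (metis append.assoc replicate_add add.commute)
  with trans show ?case by blast
next
  case (append u v u' v')
  then obtain i j k l where *: "N u @ replicate i 1 = N v @ replicate j 1"
    "N u' @ replicate k 1 = N v' @ replicate l 1"
    and S: "u \<in> lists S" "v \<in> lists S" "u' \<in> lists S" "v' \<in> lists S" by blast
  \<comment> \<open>Padding on the factors moves to the end of the product, so the invariant
    survives concatenation.\<close>
  have expand: "N (x @ y) @ replicate (m + n) 1 = N (N x @ replicate m 1 @ N y @ replicate n 1)"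
    if "x \<in> lists S" "y \<in> lists S" for x y m n
  proof -
    have "N (N x @ replicate m 1 @ (N y @ replicate n 1)) = N ((N x @ N y) @ replicate n 1) @ replicate m 1"
      using that one_in_S N_in_S[of x] N_in_S[of y] by (subst N_ones_middle) (auto simp del: N_in_S)
    also have "\<dots> = N (N x @ N y) @ replicate (m + n) 1"
      using that N_in_S[of x] N_in_S[of y]
      by (subst N_append_ones) (auto simp del: N_in_S simp: add.commute simp flip: replicate_add)
    also have "N (N x @ N y) = N (x @ y)"
      using that N_factor[of "[]" x "N y"] N_factor[of x y "[]"] by simp
    finally show ?thesis by simp
  qed
  have "N (u @ u') @ replicate (i + k) 1 = N (v @ v') @ replicate (j + l) 1"
    using expand[OF S(1,3), of i k] expand[OF S(2,4), of j l] * by (metis append.assoc)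
  with S show ?case by (metis append_in_lists_conv)
qed blast

lemma N_eq_if_prod_eq:
  assumes "u \<in> lists S" "v \<in> lists S" "length u = length v" "prod_list u = prod_list v"
  shows "N u = N v"
proof -
  have "\<exists>i j. N u @ replicate i 1 = N v @ replicate j 1"
    using monoid_cong_imp_N_eq prod_list_eq_iff_cong assms by blast
  with assms show ?thesis by auto
qed

section \<open>The factorisation map read off from \<open>N\<close>\<close>

definition short_word :: "'a \<Rightarrow> 'a list" where
  "short_word f = (SOME w. w \<in> lists S \<and> length w = mlen S f \<and> prod_list w = f)"

lemma short_word:
  "short_word f \<in> lists S" "length (short_word f) = mlen S f" "prod_list (short_word f) = f"
  using someI_ex[of "\<lambda>w. w \<in> lists S \<and> length w = mlen S f \<and> prod_list w = f"] minimal_word[of f]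
  unfolding short_word_def by blast+

text \<open>The unit is treated apart because its minimal word is empty and has no first
  letter.\<close>

definition eta :: "'a \<Rightarrow> 'a \<times> 'a" where
  "eta f = (if f = 1 then (1, 1) else (hd (N (short_word f)), prod_list (tl (N (short_word f)))))"

text \<open>Any nonempty word may replace the minimal one, as the normal forms differ only by
  trailing letters 1.\<close>

lemma eta_prod_list:
  assumes w: "w \<in> lists S" "w \<noteq> []"
  shows "eta (prod_list w) = (hd (N w), prod_list (tl (N w)))"
proof -
  define f where "f = prod_list w"
  define j where "j = length w - mlen S f"
  have len: "mlen S f \<le> length w" using mlen_prod_list_le[OF w(1)] by (simp add: f_def)
  have "N w = N (short_word f @ replicate j 1)"
    using w one_in_S short_word[of f] len
    by (intro N_eq_if_prod_eq) (auto simp: j_def f_def simp del: in_lists_conv_set)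
  also have "\<dots> = N (short_word f) @ replicate j 1"
    using short_word(1) by (rule N_append_ones)
  finally have Nw: "N w = N (short_word f) @ replicate j 1" .
  show ?thesis
  proof (cases "f = 1")
    case True
    then have "N w = replicate (length w) 1"
      using Nw short_word[of f] length_N[of "short_word f"] by (simp add: j_def)
    then show ?thesis using w True by (cases w) (simp_all add: eta_def f_def)
  next
    case False
    then have "N (short_word f) \<noteq> []"
      using short_word[of f] length_N[of "short_word f"] by (metis length_0_conv mlen_eq_0_iff)
    then show ?thesis using False unfolding Nw f_def[symmetric] by (simp add: eta_def)
  qed
qed

lemma eta_pair: "x \<in> S \<Longrightarrow> y \<in> S \<Longrightarrow> N [x, y] = [a, b] \<Longrightarrow> eta (x * y) = (a, b)"
  using eta_prod_list[of "[x, y]"] by simp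

lemma factorisation_map_eta: "factorisation_map S eta"
proof -
  have "fst (eta f) \<in> S - {1} \<and> fst (eta f) * snd (eta f) = f \<and>
      mlen S f = mlen S (fst (eta f)) + mlen S (snd (eta f))" if "f \<noteq> 1" for f
  proof -
    have len: "length (N (short_word f)) = mlen S f" and prod: "prod_list (N (short_word f)) = f"
      and inS: "N (short_word f) \<in> lists S"
      using short_word[of f] by (simp_all add: prod_list_N)
    then obtain s w where sw: "N (short_word f) = s # w"
      using \<open>f \<noteq> 1\<close> by (cases "N (short_word f)") auto
    have S: "s \<in> S" "w \<in> lists S" using inS unfolding sw by simp_all
    have eta: "eta f = (s, prod_list w)" using \<open>f \<noteq> 1\<close> by (simp add: eta_def sw)
    have f: "f = s * prod_list w" and len': "mlen S f = Suc (length w)"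
      using len prod unfolding sw by simp_all
    have le: "mlen S (prod_list w) \<le> length w" using S(2) by (rule mlen_prod_list_le)
    \<comment> \<open>Otherwise \<open>w\<close> alone would represent \<open>f\<close> with fewer
      letters than its length.\<close>
    have "s \<noteq> 1" using f le len' by auto
    then have "mlen S s = 1" using S(1) by (simp add: mlen_generator)
    then show ?thesis using eta f S(1) \<open>s \<noteq> 1\<close> le len' mlen_mult_le[of s "prod_list w"] by simp
  qed
  then show ?thesis unfolding factorisation_map_def by (simp add: eta_def)
qed

text \<open>Two appended letters 1 guarantee two letters, so elements of length below 2 need no
  separate case.\<close>

lemma long_normal_word:
  obtains x y w where "x # y # w \<in> lists S" "N (x # y # w) = x # y # w" "prod_list (x # y # w) = f"
proof -
  let ?u = "short_word f @ [1, 1]"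
  have u: "?u \<in> lists S" "prod_list ?u = f" using short_word[of f] one_in_S by auto
  then have "length (N ?u) = Suc (Suc (mlen S f))" using short_word(2)[of f] by simp
  then obtain x y w where "N ?u = x # y # w" by (metis length_Suc_conv)
  then show ?thesis using u that N_in_S[of ?u] N_idem[of ?u] prod_list_N[of ?u] by metis
qed

lemma eta_eta_head_pair: "eta (fst (eta f) * fst (eta (snd (eta f)))) = (fst (eta f), fst (eta (snd (eta f))))"
proof -
  obtain x y w where w: "x # y # w \<in> lists S" "N (x # y # w) = x # y # w" "prod_list (x # y # w) = f"
    by (rule long_normal_word)
  then have "N [x, y] = [x, y]" "N (y # w) = y # w"
    using N_fixed_Cons_Cons_iff by blast+
  then show ?thesis
    using eta_prod_list[of "x # y # w"] eta_prod_list[of "y # w"] eta_pair[of x y x y] w by simp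
qed

text \<open>The domino rule in a form suited to induction: the first letter of the result is final
  once \<open>s\<close> has met \<open>f\<close>.\<close>

lemma N_Cons_normal:
  assumes "s \<in> S" "f # v \<in> lists S" "N (f # v) = f # v" "N [s, f] = [a, b]"
  shows "N (s # f # v) = a # N (b # v)"
  using assms
proof (induction v arbitrary: s f a b)
  case Nil
  then show ?case using N_in_S[of "[s, f]"] by (simp add: N_single del: N_in_S)
next
  case (Cons g v)
  have ab: "a \<in> S" "b \<in> S" using N_in_S[of "[s, f]"] Cons.prems by simp_all
  have S: "f \<in> S" "g \<in> S" "v \<in> lists S" using Cons.prems by simp_all
  have fg: "N [f, g] = [f, g]" "N (g # v) = g # v"
    using Cons.prems N_fixed_Cons_Cons_iff by blast+
  obtain c d where cd: "N [b, g] = [c, d]" "c \<in> S" "d \<in> S" using N_pair ab S by metis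
  have IH: "N (b # g # v) = c # N (d # v)"
    using Cons.IH[of b g c d] ab S fg cd by simp
  \<comment> \<open>Since \<open>[f, g]\<close> is normal, the first of the three maps is idle; the
    other two produce \<open>a\<close>, \<open>c\<close>, \<open>d\<close>.\<close>
  have "N [s, f, g] = alternate (Nbar N) 2 3 [s, f, g]"
    using right3 Cons.prems(1) S unfolding right_class_def by simp
  also have "\<dots> = [a, c, d]"
    unfolding alternate_3 by (simp add: Nbar_def fg Cons.prems(4) cd)
  finally have "N [a, c, d] = [a, c, d]"
    using N_idem[of "[s, f, g]"] Cons.prems(1) S by simp
  then have ac: "N [a, c] = [a, c]"
    using N_fixed_Cons_Cons_iff[of a c "[d]"] ab cd by simp
  have bgv: "b # g # v \<in> lists S" using ab S by simp
  then have c_fixed: "N (c # N (d # v)) = c # N (d # v)" using N_idem IH by metis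
  have "N (s # f # g # v) = N (a # b # g # v)"
    using N_factor[of "[]" "[s, f]" "g # v"] Cons.prems S by simp
  also have "\<dots> = N (a # c # N (d # v))"
    using N_factor[of "[a]" "b # g # v" "[]"] ab bgv IH by simp
  \<comment> \<open>The junction \<open>[a, c]\<close> and the word after \<open>a\<close> are both
    normal, so the quadratic condition applies.\<close>
  also have "\<dots> = a # c # N (d # v)"
    using N_fixed_Cons_Cons_iff[of a c "N (d # v)"] ac c_fixed ab cd S N_in_S[of "d # v"] by simp
  finally show ?case using IH by simp
qed

text \<open>Translated by \<open>eta_prod_list\<close>, the domino rule becomes property
  (1).\<close>

lemma eta_left_recursive: "left_recursive S eta"
proof -
  have "eta (s * f) = (fst (eta (s * fst (eta f))), snd (eta (s * fst (eta f))) * snd (eta f))"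
    if s: "s \<in> S" for s f
  proof -
    obtain x y w where w: "x # y # w \<in> lists S" "N (x # y # w) = x # y # w" "prod_list (x # y # w) = f"
      by (rule long_normal_word)
    then obtain a b where ab: "N [s, x] = [a, b]" "a \<in> S" "b \<in> S"
      using N_pair[of s x] s by auto
    have "eta f = (x, prod_list (y # w))" using eta_prod_list[of "x # y # w"] w by simp
    moreover have "eta (s * x) = (a, b)" using eta_pair[of s x a b] s ab w by simp
    moreover have "eta (s * f) = (a, b * prod_list (y # w))"
      using eta_prod_list[of "s # x # y # w"] N_Cons_normal[OF s w(1,2) ab(1)] w s ab
        prod_list_N[of "b # y # w"] by simp
    ultimately show ?thesis by simp
  qed
  then show ?thesis unfolding left_recursive_def by (metis DiffD1 fst_conv snd_conv)
qed

text \<open>All three composite maps send a triple to the normal triple of its product, so the first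
  alternative always holds.\<close>

lemma factorability_structure_eta: "factorability_structure S eta"
proof -
  interpret factorised_monoid S eta
    by unfold_locales (rule factorisation_map_eta)
  have "F1212 eta [f, g, h] = normal_triple (f * g * h)" for f g h
    unfolding F1212_eq left_recursive_F212[OF eta_left_recursive]
    by (simp add: normal_triple_def eta_mult_def eta_eta_head_pair)
  then show ?thesis
    unfolding factorability_structure_def
    using factorisation_map_eta left_recursive_F212[OF eta_left_recursive]
      left_recursive_F2121[OF eta_left_recursive] by simp
qed

end

theorem corollary4p2p12:
  fixes S :: "'a::monoid_mult set"
  assumes "1 \<in> S" and "generates S"
  shows
    "((\<exists>N. quadratic_normalisation S N \<and> normalisation_mod_one S N \<and> of_class S N 4 3) \<longleftrightarrow>
        (\<exists>\<eta>. factorability_structure S \<eta> \<and> left_recursive S \<eta>)) \<and>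
     ((\<exists>N. quadratic_normalisation S N \<and> normalisation_mod_one S N \<and> of_class S N 4 3) \<longleftrightarrow>
        (\<exists>\<eta>. factorability_structure S \<eta> \<and> F_equal_everywhere \<eta>)) \<and>
     ((\<exists>N. quadratic_normalisation S N \<and> normalisation_mod_one S N \<and> of_class S N 4 3) \<longleftrightarrow>
        (\<exists>\<eta>. factorability_structure S \<eta> \<and> F_equal_if_one S \<eta>)) \<and>
     (\<forall>\<eta>. factorability_structure S \<eta> \<longrightarrow>
        (left_recursive S \<eta> \<longleftrightarrow> F_equal_everywhere \<eta>) \<and>
        (F_equal_everywhere \<eta> \<longleftrightarrow> F_equal_if_one S \<eta>))"
proof -
  have factorable: "factorable_monoid S \<eta>" if "factorability_structure S \<eta>" for \<eta>
    using that assms by unfold_locales (simp_all add: factorability_structure_def)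
  have normalised: "normalised_monoid S N"
    if "quadratic_normalisation S N" "normalisation_mod_one S N" "of_class S N 4 3" for N
    using that assms by unfold_locales (simp_all add: of_class_def)
  have equiv: "(left_recursive S \<eta> \<longleftrightarrow> F_equal_everywhere \<eta>) \<and>
      (F_equal_everywhere \<eta> \<longleftrightarrow> F_equal_if_one S \<eta>)" if "factorability_structure S \<eta>" for \<eta>
    using factorable_monoid.properties_equivalent[OF factorable[OF that]] by blast
  \<comment> \<open>Normalisations are linked to property (1); the other two follow from the
    equivalence for each \<open>\<eta>\<close>.\<close>
  have "(\<exists>N. quadratic_normalisation S N \<and> normalisation_mod_one S N \<and> of_class S N 4 3) \<longleftrightarrow>
        (\<exists>\<eta>. factorability_structure S \<eta> \<and> left_recursive S \<eta>)"
    using normalised factorable normalised_monoid.factorability_structure_eta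
      normalised_monoid.eta_left_recursive factorable_monoid.quadratic_normal_map
      factorable_monoid.normalisation_mod_one_normal_map factorable_monoid.of_class_normal_map
    by blast
  with equiv show ?thesis by blast
qed

end
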